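(* Let $(E,\|\cdot\|)$ be a complete random normed module over $\mathbb K$ ($\mathbb K=\mathbb R$ or $\mathbb C$) with base a probability space $(\Omega,\mathcal F,P)$ and zero element $\theta$. Let $G\subset E$ be nonempty, $L^0$-closed, $\sigma$-stable, with $\theta\in G$, and essentially bounded (there exists a real $M>0$ such that $\|g\|\le M$ almost surely for all $g\in G$). Let $\psi:[0,\infty)\to[0,\infty)$ be a Boyd--Wong function and let $f:G\to G$ be a random relaxed asymptotic contraction with respect to $\psi$. Then $f$ has a unique fixed point $z\in G$. Moreover, for every $x\in G$ the iterates $f^n x$ converge to $z$ in the $(\epsilon,\lambda)$-topology as $n\to\infty$.
   Context: Let $(\Omega,\mathcal F,P)$ be a probability space, $L^0(\mathcal F,\mathbb K)$ the algebra of equivalence classes of $\mathbb K$-valued random variables, $L^0_+(\mathcal F)$ the set of (classes of) nonnegative ones. For $A\in\mathcal F$, $\mathbf 1_A$ denotes the equivalence class of the indicator function of $A$. Random normed module (RN module) over $\mathbb K$ with base $(\Omega,\mathcal F,P)$: a pair $(E,\|\cdot\|)$ where $E$ is a left $L^0(\mathcal F,\mathbb K)$-module and $\|\cdot\|:E\to L^0_+(\mathcal F)$ satisfies, for $x,y\in E$, $\xi\in L^0(\mathcal F,\mathbb K)$: $\|x\|=0$ iff $x=\theta$ (the zero element); $\|\xi x\|=|\xi|\,\|x\|$; $\|x+y\|\le\|x\|+\|y\|$. $(\epsilon,\lambda)$-topology: the linear topology on $E$ generated by the neighbourhoods of zero $N_\theta(\epsilon,\lambda)=\{x\in E: P(\|x\|<\epsilon)\ge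 1-\lambda\}$, $\epsilon>0$, $0<\lambda<1$; $x_n\to x$ in it iff $\|x_n-x\|\to0$ in probability. Complete means complete in this topology. $G$ is $L^0$-closed if it is closed in this topology. $G\subset E$ is $\sigma$-stable if for every countable measurable partition $\{A_n\}$ of $\Omega$ and every sequence $\{x_n\}\subset G$ there is a unique $x\in G$, denoted $\sum_n\mathbf 1_{A_n}x_n$, with $\mathbf 1_{A_n}x=\mathbf 1_{A_n}x_n$ for all $n$. $G$ is stable if $\mathbf 1_Ax\in G$ for all $A\in\mathcal F$, $x\in G$. A map $f:G\to E$ has the local property if $G$ is stable and $\mathbf 1_Af(x)=f(\mathbf 1_Ax)$ for all $A\in\mathcal F$, $x\in G$. Representatives: for each $x\in G$ a representative $\tilde x:\Omega\to\mathbb R$ is fixed, and $f(x)(\omega)$ denotes the value at $\omega$ of the representative of $f(x)$; $\|x\|(\omega)$ denotes the value at $\omega$ of a fixed representative of $\|x\|$. A map $f:G\to G$ is pointwise if there is an $\mathcal F\otimes\mathcal B(\mathbb R)$-measurable function $\tilde f:\Omega\times\mathbb R\to\mathbb R$ such that for every $x\in G$ and a.e. $\omega$, $f(x)(\omega)=\tilde f(\omega,\tilde x(\omega))$. Boyd--Wong function: a function $\psi:[0,\infty)\to[0,\infty)$ that is nondecreasing, right upper semicontinuous, and satisfies $\psi(t)<t$ for all $t>0$. Quasi-metrics: for $f:G\to G$, $x,y\in G$, $\omega\in\Omega$, $P_f(x,y)(\omega)=\min\{\|x-y\|(\omega),\|x-f(y)\|(\omega),\|f(x)-y\|(\omega),\|f(x)-f(y)\|(\omega)\}$;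 $L_f(x,y)(\omega)=P_f(x,y)(\omega)$ if $P_f(x,y)(\omega)>0$, and $L_f(x,y)(\omega)=\|f(x)-f(y)\|(\omega)$ if $P_f(x,y)(\omega)=0$; $U_f(x,y)(\omega)=\max\{\|x-y\|(\omega),\|f(x)-x\|(\omega),\|f(y)-y\|(\omega),\|f(x)-f(y)\|(\omega)\}$. A map $f:G\to G$ is a random relaxed asymptotic contraction with respect to a Boyd--Wong function $\psi$ if: (1) $f$ has the local property, is pointwise, and respects $\sigma$-stability: $f(\sum_n\mathbf 1_{A_n}x_n)=\sum_n\mathbf 1_{A_n}f(x_n)$ for every countable measurable partition $\{A_n\}$ of $\Omega$ and every sequence $\{x_n\}\subset G$; (2) there exist functions $\Psi_n:\Omega\times[0,\infty)\to[0,\infty)$, $n\ge1$, with $\Psi_n(\cdot,t)$ measurable for each $t$ and $\Psi_n(\omega,\cdot)$ nondecreasing for each $\omega$, and a set $\Omega_0\subset\Omega$ with $P(\Omega_0)=1$, such that for every $\omega\in\Omega_0$: (a) for every $n\ge1$ and all $x,y\in G$, $L_f(f^nx,f^ny)(\omega)\le\Psi_n(\omega,U_f(x,y)(\omega))$; and (b) $\Psi_n(\omega,\cdot)\to\psi$ uniformly on every bounded subset of $[0,\infty)$ as $n\to\infty$; (3) for a.e. $\omega$, the map $x\mapsto f(x)(\omega)$ is continuous from $(G,\|\cdot\|(\omega))$ to itself, i.e. $f$ is continuous on $G$ with respect to the pseudometric $(x,y)\mapsto\|x-y\|(\omega)$. Here $f^n$ is the $n$-fold iterate of $f$. *)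

theory Defs
  imports "HOL-Probability.Probability" "HOL-Algebra.Module"
begin

section \<open>The algebra of random variables modulo almost sure equality\<close>

text \<open>
  A random variable is a total function on the type \<open>'a\<close>, but only its values on
  \<open>space M\<close> matter: classes are taken with respect to equality almost everywhere on \<open>M\<close>.
\<close>

definition AE_rel :: "'a measure \<Rightarrow> (('a \<Rightarrow> 'k::topological_space) \<times> ('a \<Rightarrow> 'k)) set" where
  "AE_rel M = {(f, g). f \<in> borel_measurable M \<and> g \<in> borel_measurable M \<and>
                       (AE \<omega> in M. f \<omega> = g \<omega>)}"

definition L0_class :: "'a measure \<Rightarrow> ('a \<Rightarrow> 'k::topological_space) \<Rightarrow> ('a \<Rightarrow> 'k) set" where
  "L0_class M f = AE_rel M `` {f}"

definition L0 :: "'a measure \<Rightarrow> ('a \<Rightarrow> 'k::real_normed_field) set ring" where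
  "L0 M =
    \<lparr>carrier = borel_measurable M // AE_rel M,
     mult = (\<lambda>X Y. {h \<in> borel_measurable M. \<exists>f\<in>X. \<exists>g\<in>Y. AE \<omega> in M. h \<omega> = f \<omega> * g \<omega>}),
     one = L0_class M (\<lambda>_. 1),
     zero = L0_class M (\<lambda>_. 0),
     add = (\<lambda>X Y. {h \<in> borel_measurable M. \<exists>f\<in>X. \<exists>g\<in>Y. AE \<omega> in M. h \<omega> = f \<omega> + g \<omega>})\<rparr>"

definition L0_ind :: "'a measure \<Rightarrow> 'a set \<Rightarrow> ('a \<Rightarrow> 'k::real_normed_field) set" where
  "L0_ind M A = L0_class M (indicator A)"

definition L0_abs :: "'a measure \<Rightarrow> ('a \<Rightarrow> 'k::real_normed_field) set \<Rightarrow> ('a \<Rightarrow> real) set" where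
  "L0_abs M X = {h \<in> borel_measurable M. \<exists>f\<in>X. AE \<omega> in M. h \<omega> = norm (f \<omega>)}"

definition L0_le :: "'a measure \<Rightarrow> ('a \<Rightarrow> real) set \<Rightarrow> ('a \<Rightarrow> real) set \<Rightarrow> bool" where
  "L0_le M X Y \<longleftrightarrow> (\<exists>f\<in>X. \<exists>g\<in>Y. AE \<omega> in M. f \<omega> \<le> g \<omega>)"

definition L0_nonneg :: "'a measure \<Rightarrow> ('a \<Rightarrow> real) set set" where
  "L0_nonneg M = {X \<in> carrier (L0 M). L0_le M \<zero>\<^bsub>L0 M\<^esub> X}"


section \<open>Random normed modules\<close>

text \<open>
  The scalars: \<open>real\<close> and \<open>complex\<close> are instances of
  \<open>{real_normed_field, euclidean_space}\<close>, and by Frobenius' theorem they are, up to isometric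
  isomorphism, the only ones (finite-dimensional commutative real division algebras with
  multiplicative norm).
\<close>

locale rn_module =
  prob_space M + Module.module "L0 M" E
  for M :: "'a measure"
    and E :: "(('a \<Rightarrow> 'k::{real_normed_field, euclidean_space}) set, 'e, 'm) module_scheme" (structure) +
  fixes nrm :: "'e \<Rightarrow> ('a \<Rightarrow> real) set"
  assumes nrm_nonneg: "x \<in> carrier E \<Longrightarrow> nrm x \<in> L0_nonneg M"
    and nrm_eq_zero: "x \<in> carrier E \<Longrightarrow> nrm x = \<zero>\<^bsub>L0 M\<^esub> \<longleftrightarrow> x = \<zero>\<^bsub>E\<^esub>"
    and nrm_smult: "\<xi> \<in> carrier (L0 M) \<Longrightarrow> x \<in> carrier E \<Longrightarrow>
          nrm (\<xi> \<odot>\<^bsub>E\<^esub> x) = L0_abs M \<xi> \<otimes>\<^bsub>L0 M\<^esub> nrm x"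
    and nrm_triangle: "x \<in> carrier E \<Longrightarrow> y \<in> carrier E \<Longrightarrow>
          L0_le M (nrm (x \<oplus>\<^bsub>E\<^esub> y)) (nrm x \<oplus>\<^bsub>L0 M\<^esub> nrm y)"

text \<open>The probability below does not depend on the representative \<open>f\<close> of the class \<open>nrm x\<close>.\<close>

definition eps_lambda_nhd ::
  "'a measure \<Rightarrow> (('a \<Rightarrow> 'k) set, 'e, 'm) module_scheme \<Rightarrow> ('e \<Rightarrow> ('a \<Rightarrow> real) set)
     \<Rightarrow> real \<Rightarrow> real \<Rightarrow> 'e set" where
  "eps_lambda_nhd M E nrm \<epsilon> l =
     {x \<in> carrier E. \<exists>f\<in>nrm x. measure M {\<omega> \<in> space M. f \<omega> < \<epsilon>} \<ge> 1 - l}"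

definition eps_lambda_topology ::
  "'a measure \<Rightarrow> (('a \<Rightarrow> 'k) set, 'e, 'm) module_scheme \<Rightarrow> ('e \<Rightarrow> ('a \<Rightarrow> real) set)
     \<Rightarrow> 'e topology" where
  "eps_lambda_topology M E nrm = topology (\<lambda>U. U \<subseteq> carrier E \<and>
     (\<forall>x\<in>U. \<exists>\<epsilon>>0. \<exists>l. 0 < l \<and> l < 1 \<and>
        {y \<in> carrier E. y \<ominus>\<^bsub>E\<^esub> x \<in> eps_lambda_nhd M E nrm \<epsilon> l} \<subseteq> U))"

text \<open>Completeness of the linear topology: every Cauchy filter on \<open>E\<close> converges.\<close>

definition rn_complete ::
  "'a measure \<Rightarrow> (('a \<Rightarrow> 'k) set, 'e, 'm) module_scheme \<Rightarrow> ('e \<Rightarrow> ('a \<Rightarrow> real) set) \<Rightarrow> bool" where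
  "rn_complete M E nrm \<longleftrightarrow>
     (\<forall>F. F \<noteq> bot \<and> (\<forall>\<^sub>F x in F. x \<in> carrier E) \<and>
          (\<forall>\<epsilon>>0. \<forall>l. 0 < l \<and> l < 1 \<longrightarrow>
             (\<forall>\<^sub>F (x, y) in F \<times>\<^sub>F F. x \<ominus>\<^bsub>E\<^esub> y \<in> eps_lambda_nhd M E nrm \<epsilon> l))
        \<longrightarrow> (\<exists>z. limitin (eps_lambda_topology M E nrm) (\<lambda>x. x) z F))"

definition L0_closed ::
  "'a measure \<Rightarrow> (('a \<Rightarrow> 'k) set, 'e, 'm) module_scheme \<Rightarrow> ('e \<Rightarrow> ('a \<Rightarrow> real) set)
     \<Rightarrow> 'e set \<Rightarrow> bool" where
  "L0_closed M E nrm G \<longleftrightarrow> closedin (eps_lambda_topology M E nrm) G"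

definition ess_bounded :: "'a measure \<Rightarrow> ('e \<Rightarrow> ('a \<Rightarrow> real) set) \<Rightarrow> 'e set \<Rightarrow> bool" where
  "ess_bounded M nrm G \<longleftrightarrow> (\<exists>B::real. B > 0 \<and> (\<forall>g\<in>G. L0_le M (nrm g) (L0_class M (\<lambda>_. B))))"


section \<open>Stability and the local property\<close>

text \<open>Members of a partition may be empty, so finite partitions are covered as well.\<close>

definition measurable_partition :: "'a measure \<Rightarrow> (nat \<Rightarrow> 'a set) \<Rightarrow> bool" where
  "measurable_partition M A \<longleftrightarrow>
     range A \<subseteq> sets M \<and> disjoint_family A \<and> (\<Union>n. A n) = space M"

definition is_concat ::
  "'a measure \<Rightarrow> (('a \<Rightarrow> 'k::real_normed_field) set, 'e, 'm) module_scheme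
     \<Rightarrow> (nat \<Rightarrow> 'a set) \<Rightarrow> (nat \<Rightarrow> 'e) \<Rightarrow> 'e \<Rightarrow> bool" where
  "is_concat M E A xs x \<longleftrightarrow> (\<forall>n. L0_ind M (A n) \<odot>\<^bsub>E\<^esub> x = L0_ind M (A n) \<odot>\<^bsub>E\<^esub> xs n)"

definition sigma_stable ::
  "'a measure \<Rightarrow> (('a \<Rightarrow> 'k::real_normed_field) set, 'e, 'm) module_scheme \<Rightarrow> 'e set \<Rightarrow> bool" where
  "sigma_stable M E G \<longleftrightarrow>
     (\<forall>A xs. measurable_partition M A \<and> (\<forall>n. xs n \<in> G) \<longrightarrow>
        (\<exists>!x. x \<in> G \<and> is_concat M E A xs x))"

text \<open>The element \<open>\<Sum>n. 1\<^bsub>A n\<^esub> x\<^sub>n\<close> of a \<open>\<sigma>\<close>-stable set \<open>G\<close>.\<close>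

definition concat_in ::
  "'a measure \<Rightarrow> (('a \<Rightarrow> 'k::real_normed_field) set, 'e, 'm) module_scheme \<Rightarrow> 'e set
     \<Rightarrow> (nat \<Rightarrow> 'a set) \<Rightarrow> (nat \<Rightarrow> 'e) \<Rightarrow> 'e" where
  "concat_in M E G A xs = (THE x. x \<in> G \<and> is_concat M E A xs x)"

definition stable ::
  "'a measure \<Rightarrow> (('a \<Rightarrow> 'k::real_normed_field) set, 'e, 'm) module_scheme \<Rightarrow> 'e set \<Rightarrow> bool" where
  "stable M E G \<longleftrightarrow> (\<forall>A\<in>sets M. \<forall>x\<in>G. L0_ind M A \<odot>\<^bsub>E\<^esub> x \<in> G)"

definition local_property ::
  "'a measure \<Rightarrow> (('a \<Rightarrow> 'k::real_normed_field) set, 'e, 'm) module_scheme \<Rightarrow> 'e set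
     \<Rightarrow> ('e \<Rightarrow> 'e) \<Rightarrow> bool" where
  "local_property M E G f \<longleftrightarrow> stable M E G \<and>
     (\<forall>A\<in>sets M. \<forall>x\<in>G. L0_ind M A \<odot>\<^bsub>E\<^esub> f x = f (L0_ind M A \<odot>\<^bsub>E\<^esub> x))"

definition respects_sigma_stability ::
  "'a measure \<Rightarrow> (('a \<Rightarrow> 'k::real_normed_field) set, 'e, 'm) module_scheme \<Rightarrow> 'e set
     \<Rightarrow> ('e \<Rightarrow> 'e) \<Rightarrow> bool" where
  "respects_sigma_stability M E G f \<longleftrightarrow>
     (\<forall>A xs. measurable_partition M A \<and> (\<forall>n. xs n \<in> G) \<longrightarrow>
        f (concat_in M E G A xs) = concat_in M E G A (\<lambda>n. f (xs n)))"


section \<open>Representatives\<close>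

text \<open>
  \<open>nr x \<omega>\<close> is the value at \<open>\<omega>\<close> of the fixed representative of the class \<open>nrm x\<close>; since it is
  used as an argument of functions on \<open>[0,\<infinity>)\<close>, it is chosen nonnegative everywhere.
\<close>

definition norm_representative ::
  "'a measure \<Rightarrow> (('a \<Rightarrow> 'k) set, 'e, 'm) module_scheme \<Rightarrow> ('e \<Rightarrow> ('a \<Rightarrow> real) set)
     \<Rightarrow> ('e \<Rightarrow> 'a \<Rightarrow> real) \<Rightarrow> bool" where
  "norm_representative M E nrm nr \<longleftrightarrow>
     (\<forall>x\<in>carrier E. nr x \<in> nrm x \<and> (\<forall>\<omega>\<in>space M. 0 \<le> nr x \<omega>))"

text \<open>\<open>rep x\<close> is the fixed real-valued representative of \<open>x\<close>.\<close>

definition pointwise ::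
  "'a measure \<Rightarrow> 'e set \<Rightarrow> ('e \<Rightarrow> 'a \<Rightarrow> real) \<Rightarrow> ('e \<Rightarrow> 'e) \<Rightarrow> bool" where
  "pointwise M G rep f \<longleftrightarrow>
     (\<exists>F \<in> borel_measurable (M \<Otimes>\<^sub>M (borel :: real measure)).
        \<forall>x\<in>G. AE \<omega> in M. rep (f x) \<omega> = F (\<omega>, rep x \<omega>))"


section \<open>Random relaxed asymptotic contractions\<close>

text \<open>
  Functions on \<open>[0,\<infinity>)\<close> are functions on \<open>real\<close> of which only the values on \<open>{0..}\<close> matter.
  The third clause is right upper semicontinuity: the upper limit of \<open>\<psi>\<close> at \<open>t\<close> from the right
  is at most \<open>\<psi> t\<close>.
\<close>

definition boyd_wong :: "(real \<Rightarrow> real) \<Rightarrow> bool" where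
  "boyd_wong \<psi> \<longleftrightarrow>
     (\<forall>t\<ge>0. 0 \<le> \<psi> t) \<and>
     mono_on {0..} \<psi> \<and>
     (\<forall>t\<ge>0. \<forall>c>\<psi> t. \<forall>\<^sub>F s in at_right t. \<psi> s < c) \<and>
     (\<forall>t>0. \<psi> t < t)"

definition P_metric ::
  "('c, 'e, 'm) module_scheme \<Rightarrow> ('e \<Rightarrow> 'a \<Rightarrow> real) \<Rightarrow> ('e \<Rightarrow> 'e) \<Rightarrow> 'e \<Rightarrow> 'e \<Rightarrow> 'a \<Rightarrow> real" where
  "P_metric E nr f x y \<omega> =
     Min {nr (x \<ominus>\<^bsub>E\<^esub> y) \<omega>, nr (x \<ominus>\<^bsub>E\<^esub> f y) \<omega>, nr (f x \<ominus>\<^bsub>E\<^esub> y) \<omega>, nr (f x \<ominus>\<^bsub>E\<^esub> f y) \<omega>}"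

definition L_metric ::
  "('c, 'e, 'm) module_scheme \<Rightarrow> ('e \<Rightarrow> 'a \<Rightarrow> real) \<Rightarrow> ('e \<Rightarrow> 'e) \<Rightarrow> 'e \<Rightarrow> 'e \<Rightarrow> 'a \<Rightarrow> real" where
  "L_metric E nr f x y \<omega> =
     (if P_metric E nr f x y \<omega> > 0 then P_metric E nr f x y \<omega> else nr (f x \<ominus>\<^bsub>E\<^esub> f y) \<omega>)"

definition U_metric ::
  "('c, 'e, 'm) module_scheme \<Rightarrow> ('e \<Rightarrow> 'a \<Rightarrow> real) \<Rightarrow> ('e \<Rightarrow> 'e) \<Rightarrow> 'e \<Rightarrow> 'e \<Rightarrow> 'a \<Rightarrow> real" where
  "U_metric E nr f x y \<omega> =
     Max {nr (x \<ominus>\<^bsub>E\<^esub> y) \<omega>, nr (f x \<ominus>\<^bsub>E\<^esub> x) \<omega>, nr (f y \<ominus>\<^bsub>E\<^esub> y) \<omega>, nr (f x \<ominus>\<^bsub>E\<^esub> f y) \<omega>}"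

text \<open>
  The last clause is continuity for \<open>\<lambda>x y. nr (x \<ominus> y) \<omega>\<close>, written with \<open>\<epsilon>\<close> and \<open>\<delta>\<close>: for an
  arbitrary choice of representatives this function satisfies the triangle inequality only
  almost surely for each triple of points, so for a fixed \<open>\<omega>\<close> it need not be a pseudometric.
\<close>

definition random_relaxed_asymptotic_contraction ::
  "'a measure \<Rightarrow> (('a \<Rightarrow> 'k::real_normed_field) set, 'e, 'm) module_scheme
     \<Rightarrow> ('e \<Rightarrow> 'a \<Rightarrow> real) \<Rightarrow> ('e \<Rightarrow> 'a \<Rightarrow> real) \<Rightarrow> 'e set
     \<Rightarrow> (real \<Rightarrow> real) \<Rightarrow> ('e \<Rightarrow> 'e) \<Rightarrow> bool" where
  "random_relaxed_asymptotic_contraction M E nr rep G \<psi> f \<longleftrightarrow>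
     local_property M E G f \<and> pointwise M G rep f \<and> respects_sigma_stability M E G f \<and>
     (\<exists>(\<Psi> :: nat \<Rightarrow> 'a \<Rightarrow> real \<Rightarrow> real) \<Omega>0.
        (\<forall>n\<ge>1. (\<forall>\<omega>\<in>space M. \<forall>t\<ge>0. 0 \<le> \<Psi> n \<omega> t) \<and>
                (\<forall>t\<ge>0. (\<lambda>\<omega>. \<Psi> n \<omega> t) \<in> borel_measurable M) \<and>
                (\<forall>\<omega>\<in>space M. mono_on {0..} (\<Psi> n \<omega>))) \<and>
        \<Omega>0 \<in> sets M \<and> measure M \<Omega>0 = 1 \<and>
        (\<forall>\<omega>\<in>\<Omega>0.
           (\<forall>n\<ge>1. \<forall>x\<in>G. \<forall>y\<in>G.
              L_metric E nr f ((f ^^ n) x) ((f ^^ n) y) \<omega> \<le> \<Psi> n \<omega> (U_metric E nr f x y \<omega>)) \<and>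
           (\<forall>B\<subseteq>{0..}. bounded B \<longrightarrow> uniform_limit B (\<lambda>n. \<Psi> n \<omega>) \<psi> sequentially))) \<and>
     (AE \<omega> in M. \<forall>x\<in>G. \<forall>\<epsilon>>0. \<exists>\<delta>>0. \<forall>y\<in>G.
        nr (x \<ominus>\<^bsub>E\<^esub> y) \<omega> < \<delta> \<longrightarrow> nr (f x \<ominus>\<^bsub>E\<^esub> f y) \<omega> < \<epsilon>)"


section \<open>Well-definedness\<close>

lemma equiv_AE_rel: "equiv (borel_measurable M) (AE_rel M)"
proof (rule equivI)
  show "AE_rel M \<subseteq> borel_measurable M \<times> borel_measurable M"
    by (auto simp: AE_rel_def)
  show "refl_on (borel_measurable M) (AE_rel M)"
    by (auto simp: refl_on_def AE_rel_def)
  show "sym (AE_rel M)"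
    by (rule symI) (auto simp: AE_rel_def elim: AE_mp)
  show "trans (AE_rel M)"
    by (rule transI) (auto simp: AE_rel_def elim: AE_mp)
qed

lemma L0_class_iff:
  "f \<in> borel_measurable M \<Longrightarrow>
     g \<in> L0_class M f \<longleftrightarrow> g \<in> borel_measurable M \<and> (AE \<omega> in M. f \<omega> = g \<omega>)"
  by (auto simp: L0_class_def AE_rel_def)

lemma L0_class_eq_iff:
  assumes "f \<in> borel_measurable M" "g \<in> borel_measurable M"
  shows "L0_class M f = L0_class M g \<longleftrightarrow> (AE \<omega> in M. f \<omega> = g \<omega>)"
  unfolding L0_class_def
  using eq_equiv_class_iff[OF equiv_AE_rel assms] assms by (simp add: AE_rel_def)

lemma L0_carrier_iff: "X \<in> carrier (L0 M) \<longleftrightarrow> (\<exists>f\<in>borel_measurable M. X = L0_class M f)"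
  by (auto simp: L0_def quotient_def L0_class_def)

lemma L0_zero: "\<zero>\<^bsub>L0 M\<^esub> = L0_class M (\<lambda>_. 0)" and L0_one: "\<one>\<^bsub>L0 M\<^esub> = L0_class M (\<lambda>_. 1)"
  by (simp_all add: L0_def)

lemma L0_add_class:
  fixes f g :: "'a \<Rightarrow> 'k::{real_normed_field, second_countable_topology}"
  assumes [measurable]: "f \<in> borel_measurable M" "g \<in> borel_measurable M"
  shows "L0_class M f \<oplus>\<^bsub>L0 M\<^esub> L0_class M g = L0_class M (\<lambda>\<omega>. f \<omega> + g \<omega>)"
proof -
  have "(\<exists>f'\<in>L0_class M f. \<exists>g'\<in>L0_class M g. AE \<omega> in M. h \<omega> = f' \<omega> + g' \<omega>)
      \<longleftrightarrow> (AE \<omega> in M. f \<omega> + g \<omega> = h \<omega>)" for h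
  proof
    assume "\<exists>f'\<in>L0_class M f. \<exists>g'\<in>L0_class M g. AE \<omega> in M. h \<omega> = f' \<omega> + g' \<omega>"
    then obtain f' g' where "AE \<omega> in M. f \<omega> = f' \<omega>" "AE \<omega> in M. g \<omega> = g' \<omega>"
      "AE \<omega> in M. h \<omega> = f' \<omega> + g' \<omega>"
      by (auto simp: L0_class_iff)
    then show "AE \<omega> in M. f \<omega> + g \<omega> = h \<omega>" by eventually_elim simp
  next
    assume "AE \<omega> in M. f \<omega> + g \<omega> = h \<omega>"
    then have "AE \<omega> in M. h \<omega> = f \<omega> + g \<omega>" by eventually_elim simp
    moreover have "f \<in> L0_class M f" "g \<in> L0_class M g" by (simp_all add: L0_class_iff)
    ultimately show "\<exists>f'\<in>L0_class M f. \<exists>g'\<in>L0_class M g. AE \<omega> in M. h \<omega> = f' \<omega> + g' \<omega>"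
      by blast
  qed
  then show ?thesis by (auto simp: L0_def L0_class_iff)
qed

lemma L0_mult_class:
  fixes f g :: "'a \<Rightarrow> 'k::{real_normed_field, second_countable_topology}"
  assumes [measurable]: "f \<in> borel_measurable M" "g \<in> borel_measurable M"
  shows "L0_class M f \<otimes>\<^bsub>L0 M\<^esub> L0_class M g = L0_class M (\<lambda>\<omega>. f \<omega> * g \<omega>)"
proof -
  have "(\<exists>f'\<in>L0_class M f. \<exists>g'\<in>L0_class M g. AE \<omega> in M. h \<omega> = f' \<omega> * g' \<omega>)
      \<longleftrightarrow> (AE \<omega> in M. f \<omega> * g \<omega> = h \<omega>)" for h
  proof
    assume "\<exists>f'\<in>L0_class M f. \<exists>g'\<in>L0_class M g. AE \<omega> in M. h \<omega> = f' \<omega> * g' \<omega>"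
    then obtain f' g' where "AE \<omega> in M. f \<omega> = f' \<omega>" "AE \<omega> in M. g \<omega> = g' \<omega>"
      "AE \<omega> in M. h \<omega> = f' \<omega> * g' \<omega>"
      by (auto simp: L0_class_iff)
    then show "AE \<omega> in M. f \<omega> * g \<omega> = h \<omega>" by eventually_elim simp
  next
    assume "AE \<omega> in M. f \<omega> * g \<omega> = h \<omega>"
    then have "AE \<omega> in M. h \<omega> = f \<omega> * g \<omega>" by eventually_elim simp
    moreover have "f \<in> L0_class M f" "g \<in> L0_class M g" by (simp_all add: L0_class_iff)
    ultimately show "\<exists>f'\<in>L0_class M f. \<exists>g'\<in>L0_class M g. AE \<omega> in M. h \<omega> = f' \<omega> * g' \<omega>"
      by blast
  qed
  then show ?thesis by (auto simp: L0_def L0_class_iff)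
qed

lemma cring_L0:
  "cring (L0 M :: ('a \<Rightarrow> 'k::{real_normed_field, second_countable_topology}) set ring)"
proof (rule cringI)
  let ?R = "L0 M :: ('a \<Rightarrow> 'k) set ring"
  have inv: "\<exists>Y\<in>carrier ?R. Y \<oplus>\<^bsub>?R\<^esub> X = \<zero>\<^bsub>?R\<^esub>" if "X \<in> carrier ?R" for X
  proof -
    from that obtain f where [measurable]: "f \<in> borel_measurable M" and X: "X = L0_class M f"
      by (auto simp: L0_carrier_iff)
    have "L0_class M (\<lambda>\<omega>. - f \<omega>) \<in> carrier ?R"
      unfolding L0_carrier_iff by (rule bexI[of _ "\<lambda>\<omega>. - f \<omega>"]) simp_all
    moreover have "L0_class M (\<lambda>\<omega>. - f \<omega>) \<oplus>\<^bsub>?R\<^esub> X = \<zero>\<^bsub>?R\<^esub>"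
      unfolding X by (subst L0_add_class) (simp_all add: L0_zero)
    ultimately show ?thesis by blast
  qed
  have cl: "L0_class M f \<in> carrier ?R" if "f \<in> borel_measurable M" for f
    using that by (auto simp: L0_carrier_iff)
  have ex: "\<exists>f. f \<in> borel_measurable M \<and> X = L0_class M f" if "X \<in> carrier ?R" for X
    using that by (auto simp: L0_carrier_iff)
  show "abelian_group ?R"
  proof (rule abelian_groupI)
    show "\<zero>\<^bsub>?R\<^esub> \<in> carrier ?R" unfolding L0_zero by (rule cl) simp
  qed (use inv in \<open>auto dest!: ex simp: cl L0_zero L0_add_class add_ac\<close>)
  show "Group.comm_monoid ?R"
  proof (rule comm_monoidI)
    show "\<one>\<^bsub>?R\<^esub> \<in> carrier ?R" unfolding L0_one by (rule cl) simp
  qed (auto dest!: ex simp: cl L0_one L0_mult_class mult_ac)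
  show "(X \<oplus>\<^bsub>?R\<^esub> Y) \<otimes>\<^bsub>?R\<^esub> Z = X \<otimes>\<^bsub>?R\<^esub> Z \<oplus>\<^bsub>?R\<^esub> Y \<otimes>\<^bsub>?R\<^esub> Z"
    if "X \<in> carrier ?R" "Y \<in> carrier ?R" "Z \<in> carrier ?R" for X Y Z
    using that[THEN ex] by (auto simp: L0_add_class L0_mult_class algebra_simps)
qed

context rn_module
begin

lemma eps_lambda_nhd_mono:
  assumes "\<epsilon> \<le> \<epsilon>'" "l \<le> l'"
  shows "eps_lambda_nhd M E nrm \<epsilon> l \<subseteq> eps_lambda_nhd M E nrm \<epsilon>' l'"
proof
  fix x assume "x \<in> eps_lambda_nhd M E nrm \<epsilon> l"
  then obtain f where x: "x \<in> carrier E" and f: "f \<in> nrm x"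
    and p: "measure M {\<omega> \<in> space M. f \<omega> < \<epsilon>} \<ge> 1 - l"
    by (auto simp: eps_lambda_nhd_def)
  have "nrm x \<in> carrier (L0 M)" using nrm_nonneg[OF x] by (simp add: L0_nonneg_def)
  with f have [measurable]: "f \<in> borel_measurable M"
    by (auto simp: L0_carrier_iff L0_class_iff)
  have "measure M {\<omega> \<in> space M. f \<omega> < \<epsilon>} \<le> measure M {\<omega> \<in> space M. f \<omega> < \<epsilon>'}"
    by (rule finite_measure_mono) (use assms(1) in auto)
  with p assms(2) x f show "x \<in> eps_lambda_nhd M E nrm \<epsilon>' l'"
    unfolding eps_lambda_nhd_def by force
qed

lemma openin_eps_lambda:
  "openin (eps_lambda_topology M E nrm) U \<longleftrightarrow> U \<subseteq> carrier E \<and>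
     (\<forall>x\<in>U. \<exists>\<epsilon>>0. \<exists>l. 0 < l \<and> l < 1 \<and>
        {y \<in> carrier E. y \<ominus>\<^bsub>E\<^esub> x \<in> eps_lambda_nhd M E nrm \<epsilon> l} \<subseteq> U)"
proof -
  let ?N = "\<lambda>x \<epsilon> l. {y \<in> carrier E. y \<ominus>\<^bsub>E\<^esub> x \<in> eps_lambda_nhd M E nrm \<epsilon> l}"
  let ?O = "\<lambda>U. U \<subseteq> carrier E \<and> (\<forall>x\<in>U. \<exists>\<epsilon>>0. \<exists>l. 0 < l \<and> l < 1 \<and> ?N x \<epsilon> l \<subseteq> U)"
  have "istopology ?O"
    unfolding istopology_def
  proof (intro conjI allI impI)
    fix S T assume S: "?O S" and T: "?O T"
    show "S \<inter> T \<subseteq> carrier E" using S by blast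
    show "\<forall>x\<in>S \<inter> T. \<exists>\<epsilon>>0. \<exists>l. 0 < l \<and> l < 1 \<and> ?N x \<epsilon> l \<subseteq> S \<inter> T"
    proof
      fix x assume "x \<in> S \<inter> T"
      then have "x \<in> S" "x \<in> T" by simp_all
      from bspec[OF conjunct2[OF S] this(1)] obtain \<epsilon> l
        where 1: "\<epsilon> > 0" "0 < l" "l < 1" "?N x \<epsilon> l \<subseteq> S" by (elim exE conjE)
      from bspec[OF conjunct2[OF T] \<open>x \<in> T\<close>] obtain \<epsilon>' l'
        where 2: "\<epsilon>' > 0" "0 < l'" "l' < 1" "?N x \<epsilon>' l' \<subseteq> T" by (elim exE conjE)
      have "?N x (min \<epsilon> \<epsilon>') (min l l') \<subseteq> ?N x \<epsilon> l" "?N x (min \<epsilon> \<epsilon>') (min l l') \<subseteq> ?N x \<epsilon>' l'"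
        using eps_lambda_nhd_mono[of "min \<epsilon> \<epsilon>'" \<epsilon> "min l l'" l]
          eps_lambda_nhd_mono[of "min \<epsilon> \<epsilon>'" \<epsilon>' "min l l'" l'] by auto
      with 1(4) 2(4) have "?N x (min \<epsilon> \<epsilon>') (min l l') \<subseteq> S \<inter> T" by blast
      moreover have "min \<epsilon> \<epsilon>' > 0" "min l l' > 0" "min l l' < 1" using 1 2 by auto
      ultimately show "\<exists>\<epsilon>>0. \<exists>l. 0 < l \<and> l < 1 \<and> ?N x \<epsilon> l \<subseteq> S \<inter> T"
        by (intro exI conjI)
    qed
  next
    fix \<K> assume "\<forall>K\<in>\<K>. ?O K"
    then show "\<Union>\<K> \<subseteq> carrier E" by blast
  next
    fix \<K> assume K: "\<forall>K\<in>\<K>. ?O K"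
    show "\<forall>x\<in>\<Union>\<K>. \<exists>\<epsilon>>0. \<exists>l. 0 < l \<and> l < 1 \<and> ?N x \<epsilon> l \<subseteq> \<Union>\<K>"
    proof
      fix x assume "x \<in> \<Union>\<K>"
      then obtain K where "K \<in> \<K>" "x \<in> K" by blast
      from bspec[OF conjunct2[OF bspec[OF K this(1)]] this(2)] obtain \<epsilon> l
        where "\<epsilon> > 0" "0 < l" "l < 1" "?N x \<epsilon> l \<subseteq> K" by (elim exE conjE)
      moreover from this(4) \<open>K \<in> \<K>\<close> have "?N x \<epsilon> l \<subseteq> \<Union>\<K>" by (rule subset_trans[OF _ Union_upper])
      ultimately show "\<exists>\<epsilon>>0. \<exists>l. 0 < l \<and> l < 1 \<and> ?N x \<epsilon> l \<subseteq> \<Union>\<K>"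
        by (intro exI conjI)
    qed
  qed
  then show ?thesis by (simp add: eps_lambda_topology_def)
qed

lemma topspace_eps_lambda: "topspace (eps_lambda_topology M E nrm) = carrier E"
proof -
  have "openin (eps_lambda_topology M E nrm) (carrier E)"
    unfolding openin_eps_lambda by (auto intro!: exI[of _ "1::real"] exI[of _ "1/2::real"])
  moreover have "topspace (eps_lambda_topology M E nrm) \<subseteq> carrier E"
    using openin_topspace[of "eps_lambda_topology M E nrm"] unfolding openin_eps_lambda by simp
  ultimately show ?thesis by (intro antisym openin_subset)
qed

end

end

theory Submission
  imports Defs
begin

text \<open>
  The local property produces the fixed point: multiplying by the indicator of the empty set
  sends every element to \<open>\<theta>\<close>, so \<open>f \<theta> = \<theta>\<close> (\<open>local_property_fixes_zero\<close>). It remains to see that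
  every orbit tends to \<open>\<theta>\<close>; a further fixed point has a constant orbit and hence is \<open>\<theta>\<close> itself.

  Convergence is proved almost surely (\<open>AE_orbit_tendsto_zero\<close>). Fix \<open>x\<close> and an \<open>\<omega>\<close> outside a null
  set, and write \<open>a\<^sub>n = \<parallel>f\<^sup>n x\<parallel>(\<omega>)\<close> and \<open>c\<^sub>n = \<parallel>f\<^sup>n\<^sup>+\<^sup>1 x - f\<^sup>n x\<parallel>(\<omega>)\<close>. The contraction condition is used
  for two kinds of pairs. For \<open>f\<^sup>k\<^sup>+\<^sup>1 x\<close> and \<open>f\<^sup>k x\<close> the minimum in the lower quasi-metric of the
  \<open>n\<close>-th iterates vanishes, because \<open>f\<close> maps the second of these to the first; this leaves
  \<open>c\<^sub>n\<^sub>+\<^sub>k\<^sub>+\<^sub>1 \<le> \<Psi>\<^sub>n(max(c\<^sub>k, c\<^sub>k\<^sub>+\<^sub>1))\<close>. For \<open>f\<^sup>k x\<close> and \<open>\<theta>\<close> the minimum is that of \<open>a\<^sub>n\<^sub>+\<^sub>k\<close> and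
  \<open>a\<^sub>n\<^sub>+\<^sub>k\<^sub>+\<^sub>1\<close>, and the latter exceeds the former by at most \<open>c\<^sub>n\<^sub>+\<^sub>k\<close>; this leaves
  \<open>a\<^sub>n\<^sub>+\<^sub>k\<^sub>+\<^sub>1 \<le> \<Psi>\<^sub>n(max(a\<^sub>k, a\<^sub>k\<^sub>+\<^sub>1, c\<^sub>k)) + c\<^sub>n\<^sub>+\<^sub>k\<close>. Both are instances of one asymptotic Boyd--Wong
  argument for real sequences (\<open>boyd_wong_tendsto_zero\<close>), the second with the error sequence \<open>c\<close>
  that the first has shown to vanish. Almost sure convergence of the norms implies
  convergence in probability, which is convergence in the \<open>(\<epsilon>,\<lambda>)\<close>-topology (\<open>limitin_zero_of_AE\<close>).
\<close>

section \<open>An asymptotic Boyd--Wong argument for real sequences\<close>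

text \<open>
  Let \<open>c\<close> be the upper limit of \<open>v\<close>. Letting \<open>n\<close> tend to infinity with \<open>k\<close> fixed gives \<open>c \<le> \<psi> (s k)\<close>
  for every \<open>k\<close>, while the upper limit of \<open>s\<close> is at most \<open>c\<close>. As \<open>\<psi>\<close> is monotone and right upper
  semicontinuous, \<open>c \<le> \<psi> c\<close>, which forces \<open>c = 0\<close>.
\<close>

lemma boyd_wong_tendsto_zero:
  fixes v e s :: "nat \<Rightarrow> real" and \<phi> :: "nat \<Rightarrow> real \<Rightarrow> real"
  assumes \<psi>: "boyd_wong \<psi>"
    and \<phi>: "\<And>t. 0 \<le> t \<Longrightarrow> (\<lambda>n. \<phi> n t) \<longlonglongrightarrow> \<psi> t"
    and v: "\<And>n. 0 \<le> v n" and s: "\<And>n. 0 \<le> s n"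
    and e: "e \<longlonglongrightarrow> 0"
    and contr: "\<And>n k. 1 \<le> n \<Longrightarrow> v (Suc (n + k)) \<le> \<phi> n (s k) + e (n + k)"
    and s_le: "\<And>k. s k \<le> max (v k) (v (Suc k)) + e k"
  shows "v \<longlonglongrightarrow> 0"
proof -
  have below: "\<forall>\<^sub>F n in sequentially. v n < d" if d: "\<psi> (s k) < d" for k d
  proof -
    have "(\<lambda>n. \<phi> n (s k) + e (n + k)) \<longlonglongrightarrow> \<psi> (s k) + 0"
      by (intro tendsto_add \<phi> s LIMSEQ_ignore_initial_segment[OF e])
    then have "\<forall>\<^sub>F n in sequentially. \<phi> n (s k) + e (n + k) < d"
      using d by (auto dest: order_tendstoD)
    then have "\<forall>\<^sub>F n in sequentially. v (n + Suc k) < d"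
      using eventually_ge_at_top[of 1]
    proof eventually_elim
      case (elim n)
      with contr[of n k] show ?case by simp
    qed
    then show ?thesis by (rule eventually_sequentially_seg[THEN iffD1])
  qed
  \<comment> \<open>The infimum \<open>c\<close> of \<open>T\<close> is the upper limit of \<open>v\<close>, taken in the reals since \<open>below\<close> makes \<open>v\<close>
    eventually bounded.\<close>
  define T where "T = {t. \<forall>\<^sub>F n in sequentially. v n < t}"
  define c where "c = Inf T"
  have T_pos: "0 < t" if t: "t \<in> T" for t
  proof -
    obtain n where "v n < t"
      using t eventually_happens'[OF sequentially_bot, of "\<lambda>n. v n < t"] by (auto simp: T_def)
    with v[of n] show ?thesis by linarith
  qed
  then have T_bdd: "bdd_below T" by (meson bdd_belowI less_imp_le)
  have T_ne: "T \<noteq> {}" using below[of 0 "\<psi> (s 0) + 1"] by (auto simp: T_def)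
  have c_nonneg: "0 \<le> c" unfolding c_def using T_pos by (intro cInf_greatest[OF T_ne]) force
  have above_c: "\<forall>\<^sub>F n in sequentially. v n < t" if t: "c < t" for t
  proof -
    obtain t' where "t' \<in> T" "t' < t"
      using t cInf_lessD[OF T_ne] unfolding c_def by blast
    then show ?thesis unfolding T_def by (auto elim: eventually_mono)
  qed
  have "c = 0"
  proof (rule ccontr)
    assume "c \<noteq> 0"
    with c_nonneg \<psi> have "\<psi> c < c" by (simp add: boyd_wong_def)
    \<comment> \<open>A number \<open>d\<close> strictly between \<open>\<psi> c\<close> and \<open>c\<close> turns out to be an eventual upper bound of \<open>v\<close>.\<close>
    then obtain d where d: "\<psi> c < d" "d < c" using dense by blast
    with \<psi> c_nonneg have "\<forall>\<^sub>F r in at_right c. \<psi> r < d" by (simp add: boyd_wong_def)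
    then obtain b where b: "c < b" "\<And>r. c < r \<Longrightarrow> r < b \<Longrightarrow> \<psi> r < d"
      by (auto simp: eventually_at_right_field)
    \<comment> \<open>The gap between \<open>r'\<close>, which eventually bounds \<open>v\<close>, and \<open>r\<close> absorbs the error in \<open>s_le\<close>.\<close>
    define r where "r = (c + b) / 2"
    define r' where "r' = (c + r) / 2"
    have r: "c < r'" "r' < r" "c < r" "r < b" using b(1) by (auto simp: r_def r'_def)
    have "\<forall>\<^sub>F k in sequentially. e k < r - r'"
      by (rule order_tendstoD(2)[OF e]) (use r in simp)
    moreover have "\<forall>\<^sub>F k in sequentially. v k < r'" using above_c r by blast
    moreover from this have "\<forall>\<^sub>F k in sequentially. v (Suc k) < r'"
      by (rule eventually_sequentially_Suc[THEN iffD2])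
    ultimately have "\<forall>\<^sub>F k in sequentially. s k \<le> r"
    proof eventually_elim
      case (elim k)
      with s_le[of k] show ?case by simp
    qed
    then obtain k where "s k \<le> r" using eventually_happens'[OF sequentially_bot] by blast
    then have "\<psi> (s k) \<le> \<psi> r"
      using \<psi> s[of k] by (auto simp: boyd_wong_def elim!: mono_onD)
    also have "\<dots> < d" using b r by blast
    finally have "d \<in> T" using below by (simp add: T_def)
    then have "c \<le> d" unfolding c_def by (rule cInf_lower[OF _ T_bdd])
    with d show False by simp
  qed
  with above_c v show ?thesis
    by (intro order_tendstoI) (auto intro: always_eventually less_le_trans)
qed

section \<open>Norm representatives and convergence to zero\<close>

text \<open>Dominated convergence for the indicators of the events \<open>X n < \<epsilon>\<close>.\<close>

lemma (in prob_space) AE_tendsto_zero_imp_in_probability: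
  fixes X :: "nat \<Rightarrow> 'a \<Rightarrow> real"
  assumes [measurable]: "\<And>n. X n \<in> borel_measurable M"
    and lim: "AE \<omega> in M. (\<lambda>n. X n \<omega>) \<longlonglongrightarrow> 0" and "0 < \<epsilon>"
  shows "(\<lambda>n. prob {\<omega> \<in> space M. X n \<omega> < \<epsilon>}) \<longlonglongrightarrow> 1"
proof -
  have "(\<lambda>n. expectation (indicator {\<omega> \<in> space M. X n \<omega> < \<epsilon>} :: _ \<Rightarrow> real))
          \<longlonglongrightarrow> expectation (\<lambda>_. 1 :: real)"
  proof (rule integral_dominated_convergence[where w = "\<lambda>_. 1"])
    show "AE \<omega> in M. (\<lambda>n. indicator {\<omega> \<in> space M. X n \<omega> < \<epsilon>} \<omega> :: real) \<longlonglongrightarrow> 1"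
      using lim AE_space
    proof eventually_elim
      case (elim \<omega>)
      then have "\<forall>\<^sub>F n in sequentially. X n \<omega> < \<epsilon>" using \<open>0 < \<epsilon>\<close> by (auto dest: order_tendstoD)
      then have "\<forall>\<^sub>F n in sequentially. (indicator {\<omega> \<in> space M. X n \<omega> < \<epsilon>} \<omega> :: real) = 1"
        by eventually_elim (use elim in simp)
      then show ?case by (rule tendsto_eventually)
    qed
  qed (auto simp: indicator_def)
  then show ?thesis by (simp add: prob_space)
qed

context rn_module
begin

text \<open>The indicator class of the empty set is the zero scalar.\<close>

lemma local_property_fixes_zero:
  assumes "local_property M E G f" "\<zero>\<^bsub>E\<^esub> \<in> G" "f \<zero>\<^bsub>E\<^esub> \<in> carrier E"
  shows "f \<zero>\<^bsub>E\<^esub> = \<zero>\<^bsub>E\<^esub>"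
proof -
  have ind: "L0_ind M {} = (\<zero>\<^bsub>L0 M\<^esub> :: ('a \<Rightarrow> 'k) set)"
    by (simp add: L0_ind_def L0_zero indicator_def[abs_def])
  have "L0_ind M {} \<odot>\<^bsub>E\<^esub> f \<zero>\<^bsub>E\<^esub> = f (L0_ind M {} \<odot>\<^bsub>E\<^esub> \<zero>\<^bsub>E\<^esub>)"
    using assms by (simp add: local_property_def)
  then show ?thesis using assms(3) by (simp add: ind)
qed

context
  fixes nr :: "'e \<Rightarrow> 'a \<Rightarrow> real"
  assumes nr: "norm_representative M E nrm nr"
begin

lemma nrm_eq_class:
  assumes "x \<in> carrier E"
  shows "nr x \<in> borel_measurable M" "nrm x = L0_class M (nr x)"
proof -
  have "nrm x \<in> carrier (L0 M)" using nrm_nonneg[OF assms] by (simp add: L0_nonneg_def)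
  then obtain h where h: "h \<in> borel_measurable M" "nrm x = L0_class M h"
    by (auto simp: L0_carrier_iff)
  moreover have "nr x \<in> nrm x" using nr assms by (simp add: norm_representative_def)
  ultimately show "nr x \<in> borel_measurable M" by (simp add: L0_class_iff)
  then show "nrm x = L0_class M (nr x)"
    using h \<open>nr x \<in> nrm x\<close> by (simp add: L0_class_iff L0_class_eq_iff)
qed

lemma nr_nonneg: "x \<in> carrier E \<Longrightarrow> \<omega> \<in> space M \<Longrightarrow> 0 \<le> nr x \<omega>"
  using nr by (simp add: norm_representative_def)

lemma nr_eq_zero_iff:
  assumes "x \<in> carrier E"
  shows "(AE \<omega> in M. nr x \<omega> = 0) \<longleftrightarrow> x = \<zero>\<^bsub>E\<^esub>"
  using nrm_eq_zero[OF assms] nrm_eq_class[OF assms] by (simp add: L0_zero L0_class_eq_iff)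

lemma nr_triangle:
  assumes "x \<in> carrier E" "y \<in> carrier E"
  shows "AE \<omega> in M. nr (x \<oplus>\<^bsub>E\<^esub> y) \<omega> \<le> nr x \<omega> + nr y \<omega>"
proof -
  have [measurable]: "nr x \<in> borel_measurable M" "nr y \<in> borel_measurable M"
    "nr (x \<oplus>\<^bsub>E\<^esub> y) \<in> borel_measurable M"
    using assms by (simp_all add: nrm_eq_class)
  obtain g h where "AE \<omega> in M. nr (x \<oplus>\<^bsub>E\<^esub> y) \<omega> = g \<omega>" "AE \<omega> in M. nr x \<omega> + nr y \<omega> = h \<omega>"
    "AE \<omega> in M. g \<omega> \<le> h \<omega>"
    using nrm_triangle[OF assms] assms
    by (auto simp: L0_le_def nrm_eq_class L0_add_class L0_class_iff)
  then show ?thesis by eventually_elim simp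
qed

lemma limitin_zero_of_AE:
  assumes X: "\<And>n. X n \<in> carrier E" and lim: "AE \<omega> in M. (\<lambda>n. nr (X n) \<omega>) \<longlonglongrightarrow> 0"
  shows "limitin (eps_lambda_topology M E nrm) X \<zero>\<^bsub>E\<^esub> sequentially"
  unfolding limitin_def
proof (intro conjI allI impI)
  show "\<zero>\<^bsub>E\<^esub> \<in> topspace (eps_lambda_topology M E nrm)" by (simp add: topspace_eps_lambda)
  fix U assume "openin (eps_lambda_topology M E nrm) U \<and> \<zero>\<^bsub>E\<^esub> \<in> U"
  then obtain \<epsilon> l where "\<epsilon> > 0" "0 < l"
    and U: "{y \<in> carrier E. y \<ominus>\<^bsub>E\<^esub> \<zero>\<^bsub>E\<^esub> \<in> eps_lambda_nhd M E nrm \<epsilon> l} \<subseteq> U"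
    unfolding openin_eps_lambda by blast
  have "(\<lambda>n. prob {\<omega> \<in> space M. nr (X n) \<omega> < \<epsilon>}) \<longlonglongrightarrow> 1"
    by (rule AE_tendsto_zero_imp_in_probability[OF _ lim \<open>\<epsilon> > 0\<close>]) (simp add: nrm_eq_class X)
  then have "\<forall>\<^sub>F n in sequentially. 1 - l < prob {\<omega> \<in> space M. nr (X n) \<omega> < \<epsilon>}"
    by (rule order_tendstoD(1)) (use \<open>0 < l\<close> in simp)
  then show "\<forall>\<^sub>F n in sequentially. X n \<in> U"
  proof eventually_elim
    case (elim n)
    have "nr (X n) \<in> nrm (X n)" using nr X by (simp add: norm_representative_def)
    with elim X[of n] have "X n \<in> eps_lambda_nhd M E nrm \<epsilon> l"
      unfolding eps_lambda_nhd_def by force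
    moreover have "X n \<ominus>\<^bsub>E\<^esub> \<zero>\<^bsub>E\<^esub> = X n" using X[of n] by (simp add: a_minus_def)
    ultimately show ?case using U X by auto
  qed
qed

section \<open>Orbits of random relaxed asymptotic contractions\<close>

text \<open>
  Only countably many elements, namely one orbit and \<open>\<theta>\<close>, enter the argument, so a single null set
  suffices for all the norm identities and triangle inequalities, although each of them holds only
  almost surely. The increments \<open>c\<close> have to be treated before the norms \<open>a\<close>: a bound for the
  minimum of two consecutive norms says something about each of them only once their difference
  is known to be small.
\<close>

lemma AE_orbit_tendsto_zero:
  assumes "boyd_wong \<psi>" "G \<subseteq> carrier E" "\<zero>\<^bsub>E\<^esub> \<in> G" "f \<in> G \<rightarrow> G" "x \<in> G"
    and f: "random_relaxed_asymptotic_contraction M E nr rep G \<psi> f"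
  shows "AE \<omega> in M. (\<lambda>n. nr ((f ^^ n) x) \<omega>) \<longlonglongrightarrow> 0"
proof -
  obtain \<Psi> :: "nat \<Rightarrow> 'a \<Rightarrow> real \<Rightarrow> real" and \<Omega>0 where \<Omega>0: "\<Omega>0 \<in> sets M" "prob \<Omega>0 = 1"
    and \<Psi>: "\<forall>\<omega>\<in>\<Omega>0.
      (\<forall>n\<ge>1. \<forall>y\<in>G. \<forall>w\<in>G.
         L_metric E nr f ((f ^^ n) y) ((f ^^ n) w) \<omega> \<le> \<Psi> n \<omega> (U_metric E nr f y w \<omega>)) \<and>
      (\<forall>B\<subseteq>{0..}. bounded B \<longrightarrow> uniform_limit B (\<lambda>n. \<Psi> n \<omega>) \<psi> sequentially)"
    using f unfolding random_relaxed_asymptotic_contraction_def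
    by (elim conjE exE) (rule that; assumption)
  then have contr: "L_metric E nr f ((f ^^ n) y) ((f ^^ n) w) \<omega> \<le> \<Psi> n \<omega> (U_metric E nr f y w \<omega>)"
    if "\<omega> \<in> \<Omega>0" "1 \<le> n" "y \<in> G" "w \<in> G" for \<omega> n y w
    using that by blast
  have lim: "(\<lambda>n. \<Psi> n \<omega> t) \<longlonglongrightarrow> \<psi> t" if "\<omega> \<in> \<Omega>0" "0 \<le> t" for \<omega> t
  proof -
    have "\<forall>B\<subseteq>{0..}. bounded B \<longrightarrow> uniform_limit B (\<lambda>n. \<Psi> n \<omega>) \<psi> sequentially"
      using \<Psi> that(1) by blast
    from this[rule_format, of "{t}"] that(2) show ?thesis by simp
  qed
  have f_closed: "f y \<in> G" if "y \<in> G" for y using that assms(4) by auto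
  have orbit: "(f ^^ n) x \<in> G" for n by (induction n) (auto simp: f_closed assms(5))
  then have orbit_E[simp]: "(f ^^ n) x \<in> carrier E" for n using assms(2) by blast
  have f_orbit_E[simp]: "f ((f ^^ n) x) \<in> carrier E" for n using orbit_E[of "Suc n"] by simp
  have f0: "f \<zero>\<^bsub>E\<^esub> = \<zero>\<^bsub>E\<^esub>"
    using f assms(2,3) f_closed[OF assms(3)]
    by (intro local_property_fixes_zero) (auto simp: random_relaxed_asymptotic_contraction_def)
  have iter0: "(f ^^ n) \<zero>\<^bsub>E\<^esub> = \<zero>\<^bsub>E\<^esub>" for n by (induction n) (simp_all add: f0)
  have minus_zero: "y \<ominus>\<^bsub>E\<^esub> \<zero>\<^bsub>E\<^esub> = y" if "y \<in> carrier E" for y using that by (simp add: a_minus_def)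
  have minus_self: "y \<ominus>\<^bsub>E\<^esub> y = \<zero>\<^bsub>E\<^esub>" if "y \<in> carrier E" for y
    using that by (simp add: a_minus_def M.r_neg)
  have iter_shift: "(f ^^ n) ((f ^^ k) x) = (f ^^ (n + k)) x" for n k by (simp add: funpow_add)
  have iter_shift_Suc: "(f ^^ n) (f ((f ^^ k) x)) = f ((f ^^ (n + k)) x)" for n k
    using iter_shift[of n "Suc k"] by simp
  define a where "a \<omega> n = nr ((f ^^ n) x) \<omega>" for \<omega> n
  define c where "c \<omega> n = nr (f ((f ^^ n) x) \<ominus>\<^bsub>E\<^esub> (f ^^ n) x) \<omega>" for \<omega> n
  have "AE \<omega> in M. a \<omega> (Suc n) \<le> c \<omega> n + a \<omega> n" for n
  proof -
    have "f ((f ^^ n) x) \<ominus>\<^bsub>E\<^esub> (f ^^ n) x \<oplus>\<^bsub>E\<^esub> (f ^^ n) x = f ((f ^^ n) x)"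
      by (simp add: a_minus_def M.a_assoc M.l_neg)
    with nr_triangle[of "f ((f ^^ n) x) \<ominus>\<^bsub>E\<^esub> (f ^^ n) x" "(f ^^ n) x"]
    show ?thesis by (simp add: a_def c_def)
  qed
  then have tri: "AE \<omega> in M. \<forall>n. a \<omega> (Suc n) \<le> c \<omega> n + a \<omega> n" by (simp add: AE_all_countable)
  have zero: "AE \<omega> in M. nr \<zero>\<^bsub>E\<^esub> \<omega> = 0" by (simp add: nr_eq_zero_iff)
  have "AE \<omega> in M. \<omega> \<in> \<Omega>0" using \<Omega>0 by (simp add: AE_prob_1)
  then show ?thesis using tri zero AE_space
  proof eventually_elim
    case (elim \<omega>)
    have nonneg: "0 \<le> a \<omega> n" "0 \<le> c \<omega> n" for n
      using elim by (auto simp: a_def c_def intro!: nr_nonneg)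
    have "c \<omega> \<longlonglongrightarrow> 0"
    proof (rule boyd_wong_tendsto_zero[OF assms(1) lim[OF elim(1)],
          where s = "\<lambda>k. max (c \<omega> k) (c \<omega> (Suc k))" and e = "\<lambda>_. 0"])
      fix n k :: nat assume "1 \<le> n"
      \<comment> \<open>With the later iterate as first argument, \<open>P_metric\<close> contains \<open>\<parallel>\<theta>\<parallel>\<close>, and the increments
        come out in the orientation of \<open>c\<close>.\<close>
      from contr[OF elim(1) this orbit[of "Suc k"] orbit[of k]]
      show "c \<omega> (Suc (n + k)) \<le> \<Psi> n \<omega> (max (c \<omega> k) (c \<omega> (Suc k))) + 0"
        by (simp add: L_metric_def P_metric_def U_metric_def iter_shift iter_shift_Suc minus_self
            elim(3) c_def max.commute)
    qed (auto simp: nonneg max_def)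
    show "(\<lambda>n. nr ((f ^^ n) x) \<omega>) \<longlonglongrightarrow> 0"
      unfolding a_def[symmetric]
    proof (rule boyd_wong_tendsto_zero[OF assms(1) lim[OF elim(1)],
          where s = "\<lambda>k. max (max (a \<omega> k) (a \<omega> (Suc k))) (c \<omega> k)" and e = "c \<omega>"])
      fix n k :: nat assume "1 \<le> n"
      have U: "U_metric E nr f ((f ^^ k) x) \<zero>\<^bsub>E\<^esub> \<omega> = max (max (a \<omega> k) (a \<omega> (Suc k))) (c \<omega> k)"
        using nonneg[of k]
        by (simp add: U_metric_def f0 minus_zero minus_self elim(3) a_def c_def max_def)
      have "a \<omega> (Suc (n + k)) \<le> L_metric E nr f ((f ^^ (n + k)) x) \<zero>\<^bsub>E\<^esub> \<omega> + c \<omega> (n + k)"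
        using elim(2)[rule_format, of "n + k"] nonneg(2)[of "n + k"]
        by (auto simp: L_metric_def P_metric_def f0 minus_zero a_def)
      also have "\<dots> \<le> \<Psi> n \<omega> (U_metric E nr f ((f ^^ k) x) \<zero>\<^bsub>E\<^esub> \<omega>) + c \<omega> (n + k)"
        using contr[OF elim(1) \<open>1 \<le> n\<close> orbit[of k] assms(3)] by (simp add: iter_shift iter0)
      finally show "a \<omega> (Suc (n + k)) \<le>
          \<Psi> n \<omega> (max (max (a \<omega> k) (a \<omega> (Suc k))) (c \<omega> k)) + c \<omega> (n + k)"
        by (simp add: U)
    qed (use \<open>c \<omega> \<longlonglongrightarrow> 0\<close> nonneg in \<open>auto simp: max_def add_increasing\<close>)
  qed
qed

end

end

theorem theorem3p4:
  fixes M :: "'a measure"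
    and E :: "(('a \<Rightarrow> 'k::{real_normed_field, euclidean_space}) set, 'e, 'm) module_scheme"
    and nrm :: "'e \<Rightarrow> ('a \<Rightarrow> real) set"
    and nr rep :: "'e \<Rightarrow> 'a \<Rightarrow> real"
    and G :: "'e set"
    and \<psi> :: "real \<Rightarrow> real"
    and f :: "'e \<Rightarrow> 'e"
  assumes "rn_module M E nrm"
    and "rn_complete M E nrm"
    and "norm_representative M E nrm nr"
    and "G \<subseteq> carrier E"
    and "G \<noteq> {}"
    and "L0_closed M E nrm G"
    and "sigma_stable M E G"
    and "\<zero>\<^bsub>E\<^esub> \<in> G"
    and "ess_bounded M nrm G"
    and "\<forall>x\<in>G. rep x \<in> borel_measurable M"
    and "boyd_wong \<psi>"
    and "f \<in> G \<rightarrow> G"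
    and "random_relaxed_asymptotic_contraction M E nr rep G \<psi> f"
  shows "\<exists>z\<in>G. f z = z \<and> (\<forall>w\<in>G. f w = w \<longrightarrow> w = z) \<and>
           (\<forall>x\<in>G. limitin (eps_lambda_topology M E nrm) (\<lambda>n. (f ^^ n) x) z sequentially)"
proof -
  interpret rn_module M E nrm by fact
  note nr = \<open>norm_representative M E nrm nr\<close>
  have G: "G \<subseteq> carrier E" "\<zero>\<^bsub>E\<^esub> \<in> G" and f: "f \<in> G \<rightarrow> G" by fact+
  have lim: "AE \<omega> in M. (\<lambda>n. nr ((f ^^ n) x) \<omega>) \<longlonglongrightarrow> 0" if "x \<in> G" for x
    using AE_orbit_tendsto_zero[OF nr \<open>boyd_wong \<psi>\<close> G f that] assms(13) by blast
  have "f \<zero>\<^bsub>E\<^esub> = \<zero>\<^bsub>E\<^esub>"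
    using assms(13) G f
    by (intro local_property_fixes_zero) (auto simp: random_relaxed_asymptotic_contraction_def)
  moreover have "w = \<zero>\<^bsub>E\<^esub>" if w: "w \<in> G" "f w = w" for w
  proof -
    have "(f ^^ n) w = w" for n by (induction n) (simp_all add: w)
    with lim[OF w(1)] have "AE \<omega> in M. nr w \<omega> = 0" by (simp add: LIMSEQ_const_iff)
    with w G show ?thesis by (simp add: nr_eq_zero_iff[OF nr] subset_iff)
  qed
  moreover have "limitin (eps_lambda_topology M E nrm) (\<lambda>n. (f ^^ n) x) \<zero>\<^bsub>E\<^esub> sequentially"
    if x: "x \<in> G" for x
  proof (rule limitin_zero_of_AE[OF nr _ lim[OF x]])
    show "(f ^^ n) x \<in> carrier E" for n
    proof -
      have "(f ^^ n) x \<in> G" using x f by (induction n) auto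
      with G show ?thesis by blast
    qed
  qed
  ultimately show ?thesis using G by blast
qed

end
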